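(* Let $p,q\geq 3$ be integers. The Sombor coindex of the $C_4$ nanotorus $C_p\square C_q$ is $$\overline{SO}(C_p\square C_q)=2\sqrt{2}\,pq(pq-5).$$
   Context: $C_n$ ($n\geq 3$) is the cycle on $n$ vertices. The Cartesian product $G_1\square G_2$ is the graph with vertex set $V(G_1)\times V(G_2)$ in which $(u_1,u_2)$ is adjacent to $(v_1,v_2)$ whenever ($u_1=v_1$ and $u_2v_2\in E(G_2)$) or ($u_2=v_2$ and $u_1v_1\in E(G_1)$). $d_G(u)$ denotes the degree of $u$ in $G$, and $\overline{G}$ is the complement of $G$. The Sombor coindex of $G$ is $$\overline{SO}(G)=\sum_{uv\in E(\overline{G})}\sqrt{d_G(u)^2+d_G(v)^2},$$ the sum being over unordered pairs of distinct non-adjacent vertices of $G$, with degrees taken in $G$. *)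

theory Defs
  imports Complex_Main "Graph_Theory.Pair_Digraph"
begin

text \<open>
  A finite simple graph is a \<^locale>\<open>pair_graph\<close>: a finite, loop-free, symmetric digraph whose
  arcs are pairs of vertices. Each undirected edge \<open>uv\<close> is present as the two arcs \<open>(u, v)\<close>
  and \<open>(v, u)\<close>; \<open>uedges\<close> collapses them, so that a sum over \<open>uedges G\<close> counts every
  edge once. By symmetry the degree of a vertex is its \<^const>\<open>out_degree\<close>.
\<close>

definition uedges :: "'a pair_pre_digraph \<Rightarrow> 'a set set" where
  "uedges G = {{u, v} | u v. (u, v) \<in> parcs G}"

definition cycle_graph :: "nat \<Rightarrow> nat pair_pre_digraph" where
  "cycle_graph n = \<lparr> pverts = {..<n},
     parcs = {(i, j). i < n \<and> j < n \<and> (j = (i + 1) mod n \<or> i = (j + 1) mod n)} \<rparr>"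

definition cartesian_product ::
    "'a pair_pre_digraph \<Rightarrow> 'b pair_pre_digraph \<Rightarrow> ('a \<times> 'b) pair_pre_digraph" where
  "cartesian_product G H = \<lparr> pverts = pverts G \<times> pverts H,
     parcs = {((u1, u2), (v1, v2)).
       (u1 = v1 \<and> u1 \<in> pverts G \<and> (u2, v2) \<in> parcs H) \<or>
       (u2 = v2 \<and> u2 \<in> pverts H \<and> (u1, v1) \<in> parcs G)} \<rparr>"

definition complement :: "'a pair_pre_digraph \<Rightarrow> 'a pair_pre_digraph" where
  "complement G = \<lparr> pverts = pverts G,
     parcs = {(u, v). u \<in> pverts G \<and> v \<in> pverts G \<and> u \<noteq> v \<and> (u, v) \<notin> parcs G} \<rparr>"

text \<open>
  For an edge \<open>e = {u, v}\<close> with \<open>u \<noteq> v\<close> the inner sum below is \<open>d(u)\<^sup>2 + d(v)\<^sup>2\<close>.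
  The edges range over the complement, the degrees are those of \<open>G\<close> itself.
\<close>

definition sombor_coindex :: "'a pair_pre_digraph \<Rightarrow> real" where
  "sombor_coindex G =
     (\<Sum>e \<in> uedges (complement G). sqrt (\<Sum>u \<in> e. (real (out_degree G u))\<^sup>2))"

lemma pair_graph_cycle_graph:
  assumes "n \<ge> 3"
  shows "pair_graph (cycle_graph n)"
proof
  have "parcs (cycle_graph n) \<subseteq> {..<n} \<times> {..<n}"
    by (auto simp: cycle_graph_def)
  then show "finite (parcs (cycle_graph n))"
    by (rule finite_subset) simp
next
  fix e assume "e \<in> parcs (cycle_graph n)"
  then show "fst e \<noteq> snd e"
    using assms by (auto simp: cycle_graph_def mod_Suc split: if_splits)
qed (auto simp: cycle_graph_def symmetric_def sym_def)

lemma pair_graph_cartesian_product: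
  assumes "pair_graph G" "pair_graph H"
  shows "pair_graph (cartesian_product G H)"
proof -
  interpret G: pair_graph G by fact
  interpret H: pair_graph H by fact
  show ?thesis
  proof
    have "parcs (cartesian_product G H) \<subseteq> (pverts G \<times> pverts H) \<times> (pverts G \<times> pverts H)"
      by (auto simp: cartesian_product_def dest: G.wellformed' H.wellformed')
    then show "finite (parcs (cartesian_product G H))"
      by (rule finite_subset) simp
  qed (auto simp: cartesian_product_def symmetric_def sym_def
         dest: G.wellformed' H.wellformed' G.no_loops' H.no_loops'
           G.arcs_symmetric H.arcs_symmetric)
qed

lemma pair_graph_complement:
  assumes "pair_graph G"
  shows "pair_graph (complement G)"
proof -
  interpret G: pair_graph G by fact
  show ?thesis
  proof
    have "parcs (complement G) \<subseteq> pverts G \<times> pverts G"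
      by (auto simp: complement_def)
    then show "finite (parcs (complement G))"
      by (rule finite_subset) simp
  qed (auto simp: complement_def symmetric_def sym_def dest: G.arcs_symmetric)
qed

end

theory Submission
  imports Defs
begin

text \<open>
  The torus is 4-regular on \<open>n = pq\<close> vertices: a cycle is 2-regular, and degrees add in a Cartesian
  product (\<open>out_degree_cartesian_product\<close>). In a \<open>k\<close>-regular graph every non-adjacent pair
  contributes the same amount \<open>sqrt (k\<^sup>2 + k\<^sup>2) = k * sqrt 2\<close> to the Sombor coindex, so only the
  number of such pairs is needed. Each vertex has \<open>n - 1 - k\<close> non-neighbours other than itself, and
  by the handshake lemma there are \<open>n (n - 1 - k) / 2\<close> non-adjacent pairs. For \<open>k = 4\<close> the product
  is \<open>4 * sqrt 2 * n (n - 5) / 2\<close>.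
\<close>

lemma out_degree_eq_card_neighbours:
  fixes G :: "'a pair_pre_digraph"
  shows "out_degree G v = card (parcs G `` {v})"
proof -
  have "out_arcs G v = Pair v ` (parcs G `` {v})"
    by (auto simp: out_arcs_def)
  then show ?thesis
    by (simp add: out_degree_def card_image inj_on_def)
qed

lemma (in pair_graph) neighbours_subset: "parcs G `` {v} \<subseteq> pverts G"
  by (auto dest: wellformed')

lemma (in pair_graph) finite_neighbours: "finite (parcs G `` {v})"
  using neighbours_subset by (rule finite_subset) simp

text \<open>
  The map sending an arc to its set of endpoints is two-to-one onto the edges: the fibre of
  \<open>{u, v}\<close> is \<open>{(u, v), (v, u)}\<close>, whose two arcs are distinct because there are no loops.
\<close>

lemma (in pair_graph) card_parcs_eq_twice_card_uedges:
  "card (parcs G) = 2 * card (uedges G)"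
proof -
  define ends :: "'a \<times> 'a \<Rightarrow> 'a set" where "ends = (\<lambda>(u, v). {u, v})"
  have edges: "uedges G = ends ` parcs G"
    by (auto simp: uedges_def ends_def image_def)
  have fibre: "card {a \<in> parcs G. ends a = e} = 2" if "e \<in> uedges G" for e
  proof -
    obtain u v where uv: "e = {u, v}" "(u, v) \<in> parcs G"
      using \<open>e \<in> uedges G\<close> by (auto simp: uedges_def)
    then have "u \<noteq> v" "(v, u) \<in> parcs G"
      by (auto dest: no_loops' arcs_symmetric)
    with uv have "{a \<in> parcs G. ends a = e} = {(u, v), (v, u)}"
      by (auto simp: ends_def doubleton_eq_iff)
    with \<open>u \<noteq> v\<close> show ?thesis
      by simp
  qed
  have "card (parcs G) = (\<Sum>e \<in> uedges G. card {a \<in> parcs G. ends a = e})"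
    using sum.image_gen[of "parcs G" "\<lambda>_. 1 :: nat" ends] by (simp add: edges)
  also have "\<dots> = 2 * card (uedges G)"
    by (simp add: fibre)
  finally show ?thesis .
qed

lemma (in pair_graph) handshake:
  "(\<Sum>v \<in> pverts G. out_degree G v) = 2 * card (uedges G)"
proof -
  have "parcs G = (SIGMA v:pverts G. parcs G `` {v})"
    by (auto dest: wellformed')
  then have "card (parcs G) = card (SIGMA v:pverts G. parcs G `` {v})"
    by (rule arg_cong)
  also have "\<dots> = (\<Sum>v \<in> pverts G. out_degree G v)"
    by (simp add: card_SigmaI finite_neighbours out_degree_eq_card_neighbours)
  finally show ?thesis
    by (simp add: card_parcs_eq_twice_card_uedges)
qed

text \<open>The equation is additive so that no natural-number subtraction is involved.\<close>

lemma (in pair_graph) out_degree_complement: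
  assumes "v \<in> pverts G"
  shows "out_degree (complement G) v + out_degree G v + 1 = card (pverts G)"
proof -
  have split: "pverts G = insert v (parcs (complement G) `` {v} \<union> parcs G `` {v})"
    using assms neighbours_subset[of v] by (auto simp: complement_def)
  have "v \<notin> parcs (complement G) `` {v} \<union> parcs G `` {v}"
    by (auto simp: complement_def dest: no_loops')
  moreover have "finite (parcs (complement G) `` {v})"
    by (rule finite_subset[of _ "pverts G"]) (auto simp: complement_def)
  moreover have "parcs (complement G) `` {v} \<inter> parcs G `` {v} = {}"
    by (auto simp: complement_def)
  ultimately show ?thesis
    by (subst split)
      (simp add: card_Un_disjoint finite_neighbours out_degree_eq_card_neighbours)
qed

lemma (in pair_graph) sombor_coindex_regular:
  assumes regular: "\<And>v. v \<in> pverts G \<Longrightarrow> out_degree G v = k"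
  defines "n \<equiv> real (card (pverts G))"
  shows "sombor_coindex G = sqrt 2 * real k * n * (n - 1 - real k) / 2"
proof -
  interpret C: pair_graph "complement G"
    by (rule pair_graph_complement) unfold_locales
  have verts: "pverts (complement G) = pverts G"
    by (simp add: complement_def)
  have codegree: "real (out_degree (complement G) v) = n - 1 - real k" if "v \<in> pverts G" for v
    using out_degree_complement[OF that] regular[OF that] by (simp add: n_def flip: of_nat_add)
  have "2 * real (card (uedges (complement G)))
      = (\<Sum>v \<in> pverts G. real (out_degree (complement G) v))"
    using C.handshake by (simp add: verts flip: of_nat_sum)
  also have "\<dots> = n * (n - 1 - real k)"
    by (simp add: codegree n_def)
  finally have count: "real (card (uedges (complement G))) = n * (n - 1 - real k) / 2"
    by simp
  have weight: "sqrt (\<Sum>u \<in> e. (real (out_degree G u))\<^sup>2) = sqrt 2 * real k"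
    if "e \<in> uedges (complement G)" for e
  proof -
    obtain u v where "e = {u, v}" "u \<in> pverts G" "v \<in> pverts G" "u \<noteq> v"
      using \<open>e \<in> uedges (complement G)\<close> by (auto simp: uedges_def complement_def)
    then have "(\<Sum>u \<in> e. (real (out_degree G u))\<^sup>2) = 2 * (real k)\<^sup>2"
      by (simp add: regular)
    then show ?thesis
      by (simp add: real_sqrt_mult)
  qed
  have "sombor_coindex G = real (card (uedges (complement G))) * (sqrt 2 * real k)"
    by (simp add: sombor_coindex_def weight)
  then show ?thesis
    by (simp add: count)
qed

text \<open>
  A neighbour of \<open>(u, v)\<close> changes exactly one coordinate; looplessness makes the two kinds of
  neighbour disjoint.
\<close>

lemma out_degree_cartesian_product:
  assumes "pair_graph G" "pair_graph H" "u \<in> pverts G" "v \<in> pverts H"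
  shows "out_degree (cartesian_product G H) (u, v) = out_degree G u + out_degree H v"
proof -
  interpret G: pair_graph G by fact
  interpret H: pair_graph H by fact
  have "parcs (cartesian_product G H) `` {(u, v)}
      = (\<lambda>u'. (u', v)) ` (parcs G `` {u}) \<union> Pair u ` (parcs H `` {v})"
    using assms(3,4) by (auto simp: cartesian_product_def)
  moreover have "(\<lambda>u'. (u', v)) ` (parcs G `` {u}) \<inter> Pair u ` (parcs H `` {v}) = {}"
    by (auto dest: G.no_loops')
  ultimately show ?thesis
    by (simp add: out_degree_eq_card_neighbours card_Un_disjoint card_image inj_on_def
        G.finite_neighbours H.finite_neighbours)
qed

lemma out_degree_cycle_graph:
  assumes "n \<ge> 3" "i < n"
  shows "out_degree (cycle_graph n) i = 2"
proof -
  define pred where "pred = (if i = 0 then n - 1 else i - 1)"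
  have "parcs (cycle_graph n) `` {i} = {(i + 1) mod n, pred}"
    using assms by (auto simp: cycle_graph_def pred_def mod_Suc split: if_splits)
  \<comment> \<open>The two neighbours would coincide for \<open>n = 2\<close>.\<close>
  moreover have "(i + 1) mod n \<noteq> pred"
    using assms by (auto simp: pred_def mod_Suc)
  ultimately show ?thesis
    by (simp add: out_degree_eq_card_neighbours)
qed

theorem corollary5p6:
  fixes p q :: nat
  assumes "p \<ge> 3" and "q \<ge> 3"
  shows "sombor_coindex (cartesian_product (cycle_graph p) (cycle_graph q)) =
    2 * sqrt 2 * (real p * real q) * (real p * real q - 5)"
proof -
  let ?T = "cartesian_product (cycle_graph p) (cycle_graph q)"
  have cycles: "pair_graph (cycle_graph p)" "pair_graph (cycle_graph q)"
    using assms by (simp_all add: pair_graph_cycle_graph)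
  then interpret T: pair_graph ?T
    by (rule pair_graph_cartesian_product)
  have verts: "pverts ?T = {..<p} \<times> {..<q}"
    by (simp add: cartesian_product_def cycle_graph_def)
  have "out_degree ?T x = 4" if "x \<in> pverts ?T" for x
  proof -
    obtain i j where x: "x = (i, j)" "i < p" "j < q"
      using \<open>x \<in> pverts ?T\<close> by (auto simp: verts)
    then have "out_degree ?T x = out_degree (cycle_graph p) i + out_degree (cycle_graph q) j"
      using out_degree_cartesian_product[OF cycles, of i j] by (simp add: cycle_graph_def)
    then show ?thesis
      using x assms by (simp add: out_degree_cycle_graph)
  qed
  from T.sombor_coindex_regular[OF this] show ?thesis
    by (simp add: verts algebra_simps)
qed

end
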